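(* Let $I$ be a finite set and $T$ a tree on $I$. The interval $[\widehat{0},T]$ in the poset of forests on $I$ ordered by $\subseteq$ is isomorphic to the intersection lattice $L_T$ of the arrangement $H_T$. More precisely, the bijection $a\mapsto F_a$ from $L_T$ to the set of forests $F$ on $I$ with $F\subseteq T$ maps the reverse inclusion order of $L_T$ to the relation $\subseteq$: for $a,b\in L_T$, one has $a\supseteq b$ (as subspaces of $\mathbb{C}^I$) if and only if $F_a\subseteq F_b$.
   Context: A tree on a finite set $I$ is a labeled rooted tree with vertex set $I$; equivalently, a partial order $\leq_T$ on $I$ with a unique minimal element (the root) such that the interval between the root and any element is a chain. $H_T$ is the central hyperplane arrangement in $\mathbb{C}^I$ (coordinates $x_i$) consisting of the hyperplanes $x_i=x_j$ for $i<_T j$. $L_T$ is the lattice of all intersections of hyperplanes of $H_T$ (including $\mathbb{C}^I$, the empty intersection), ordered by reverse inclusion. A forest on $I$ is an acyclic graph with vertex set $I$ in which each connected component has a distinguished vertex called its root; so it is a partition $\pi(F)$ of $I$ together with a rooted tree on each part. A forest $F$ is seen as a poset $(I,\leq_F)$: $i\leq_F j$ if $i,j$ are in the same tree of $F$ and $i$ is on the path from $j$ to the root of this tree. For forests $F',F$ on $I$, $F'\subseteq F$ means: the partition $\pi(F')$ is finer than (or equal to) $\pi(F)$, and each tree of $F'$ is induced by $F$ as a poset (i.e. on each part of $\pi(F')$ the order $\leq_{F'}$ is the restriction of $\leq_F$). This is a partial order, with unique minimal element $\widehat{0}$, the forest in which every vertex is a root. For $a\in L_T$, $F_a$ is the forest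 on $I$ defined as a poset by: $i\leq_{F_a} j$ if and only if $i\leq_T j$ and the linear form $x_i-x_j$ vanishes on $a$. The map $a\mapsto F_a$ is a bijection from $L_T$ onto the set of forests $F$ on $I$ with $F\subseteq T$. *)

theory Defs
  imports "HOL-Analysis.Analysis"
begin

section \<open>Trees and forests as posets\<close>

text \<open>An order \<open>\<le>\<close> on \<open>I\<close> is the relation \<open>{(i, j). i \<le> j}\<close>, contained in \<open>I \<times> I\<close>.\<close>

definition minimal_in :: "'a set \<Rightarrow> 'a rel \<Rightarrow> 'a \<Rightarrow> bool" where
  "minimal_in I T r \<longleftrightarrow> r \<in> I \<and> (\<forall>i\<in>I. (i, r) \<in> T \<longrightarrow> i = r)"

definition tree_on :: "'a set \<Rightarrow> 'a rel \<Rightarrow> bool" where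
  "tree_on I T \<longleftrightarrow>
     partial_order_on I T \<and>
     (\<exists>!r. minimal_in I T r) \<and>
     (\<forall>r j. minimal_in I T r \<longrightarrow> j \<in> I \<longrightarrow> {k. (r, k) \<in> T \<and> (k, j) \<in> T} \<in> Chains T)"

text \<open>The partition \<open>\<pi>(F)\<close> into the vertex sets of the trees of \<open>F\<close>, that is, the connected
  components of the comparability graph of \<open>F\<close>.\<close>

definition parts :: "'a set \<Rightarrow> 'a rel \<Rightarrow> 'a set set" where
  "parts I F = I // {(i, j) \<in> I \<times> I. (i, j) \<in> (F \<union> F\<inverse>)\<^sup>*}"

definition forest_on :: "'a set \<Rightarrow> 'a rel \<Rightarrow> bool" where
  "forest_on I F \<longleftrightarrow> F \<subseteq> I \<times> I \<and> (\<forall>B\<in>parts I F. tree_on B (F \<inter> B \<times> B))"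

definition subforest :: "'a set \<Rightarrow> 'a rel \<Rightarrow> 'a rel \<Rightarrow> bool" where
  "subforest I F' F \<longleftrightarrow>
     refines I (parts I F') (parts I F) \<and>
     (\<forall>B\<in>parts I F'. F' \<inter> B \<times> B = F \<inter> B \<times> B)"

definition forest_bot :: "'a set \<Rightarrow> 'a rel" where
  "forest_bot I = Id_on I"

definition forest_interval :: "'a set \<Rightarrow> 'a rel \<Rightarrow> 'a rel \<Rightarrow> 'a rel set" where
  "forest_interval I F G = {E. forest_on I E \<and> subforest I F E \<and> subforest I E G}"

section \<open>The arrangement and its intersection lattice\<close>

text \<open>\<open>\<complex>\<^sup>I\<close> is represented by the extensional functions \<open>I \<rightarrow>\<^sub>E UNIV\<close>.\<close>

definition complex_space :: "'a set \<Rightarrow> ('a \<Rightarrow> complex) set" where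
  "complex_space I = I \<rightarrow>\<^sub>E UNIV"

definition arrangement :: "'a set \<Rightarrow> 'a rel \<Rightarrow> ('a \<Rightarrow> complex) set set" where
  "arrangement I T = {{x \<in> complex_space I. x i = x j} | i j. (i, j) \<in> T \<and> i \<noteq> j}"

text \<open>Intersecting with \<open>complex_space I\<close> makes the empty intersection equal to \<open>\<complex>\<^sup>I\<close>.\<close>

definition intersection_lattice :: "'a set \<Rightarrow> 'a rel \<Rightarrow> ('a \<Rightarrow> complex) set set" where
  "intersection_lattice I T = {complex_space I \<inter> \<Inter>S | S. S \<subseteq> arrangement I T}"

definition flat_forest :: "'a rel \<Rightarrow> ('a \<Rightarrow> complex) set \<Rightarrow> 'a rel" where
  "flat_forest T a = {(i, j). (i, j) \<in> T \<and> (\<forall>x\<in>a. x i - x j = 0)}"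

section \<open>Isomorphism of posets\<close>

definition order_isomorphism ::
  "'a set \<Rightarrow> ('a \<Rightarrow> 'a \<Rightarrow> bool) \<Rightarrow> 'b set \<Rightarrow> ('b \<Rightarrow> 'b \<Rightarrow> bool) \<Rightarrow> ('a \<Rightarrow> 'b) \<Rightarrow> bool" where
  "order_isomorphism A leA B leB f \<longleftrightarrow>
     bij_betw f A B \<and> (\<forall>x\<in>A. \<forall>y\<in>A. leA x y \<longleftrightarrow> leB (f x) (f y))"

section \<open>Agreement with the description by partitions\<close>

lemma partition_on_parts: "partition_on I (parts I F)"
  unfolding parts_def
proof (intro partition_on_quotient equivI)
  show "sym {(i, j) \<in> I \<times> I. (i, j) \<in> (F \<union> F\<inverse>)\<^sup>*}"
    using sym_rtrancl[OF sym_Un_converse[of F]] by (auto simp: sym_def)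
  show "trans {(i, j) \<in> I \<times> I. (i, j) \<in> (F \<union> F\<inverse>)\<^sup>*}"
    by (auto intro!: transI intro: rtrancl_trans)
qed (auto simp: refl_on_def)

lemma parts_cover:
  assumes "F \<subseteq> I \<times> I" "(i, j) \<in> F"
  shows "\<exists>B\<in>parts I F. i \<in> B \<and> j \<in> B"
proof -
  have "i \<in> I" using assms by auto
  then obtain B where B: "B \<in> parts I F" "i \<in> B"
    using partition_on_parts[of I F] by (auto simp: partition_on_def)
  then have "j \<in> B"
    using assms by (auto simp: parts_def quotient_def intro: rtrancl_into_rtrancl)
  then show ?thesis using B by blast
qed

lemma tree_on_root:
  assumes "finite I" "tree_on I T"
  obtains r where "r \<in> I" "\<And>i. i \<in> I \<Longrightarrow> (r, i) \<in> T"
proof -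
  have po: "partial_order_on I T" and ex1: "\<exists>!r. minimal_in I T r"
    using assms by (auto simp: tree_on_def)
  obtain r where r: "minimal_in I T r" and uniq: "\<And>s. minimal_in I T s \<Longrightarrow> s = r"
    using ex1 by auto
  have tr: "trans T" and asy: "antisym T" and rf: "\<And>x. x \<in> I \<Longrightarrow> (x, x) \<in> T"
    using po by (auto simp: partial_order_on_def preorder_on_def refl_on_def)
  have "(r, i) \<in> T" if "i \<in> I" for i
    using that
  proof (induction "card {k \<in> I. (k, i) \<in> T}" arbitrary: i rule: less_induct)
    case less
    show ?case
    proof (cases "minimal_in I T i")
      case True
      then show ?thesis using uniq rf less.prems by auto
    next
      case False
      then obtain k where k: "k \<in> I" "(k, i) \<in> T" "k \<noteq> i"
        using less.prems by (auto simp: minimal_in_def)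
      have "(i, k) \<notin> T" using k asy by (auto dest: antisymD)
      then have "{l \<in> I. (l, k) \<in> T} \<subset> {l \<in> I. (l, i) \<in> T}"
        using k less.prems rf tr by (auto dest: transD)
      then have "card {l \<in> I. (l, k) \<in> T} < card {l \<in> I. (l, i) \<in> T}"
        using assms(1) by (intro psubset_card_mono) auto
      then have "(r, k) \<in> T" using less.hyps k by blast
      then show ?thesis using k tr by (auto dest: transD)
    qed
  qed
  then show ?thesis using that r by (auto simp: minimal_in_def)
qed

lemma parts_unique:
  assumes fin: "finite I" and P: "partition_on I P" and sub: "F \<subseteq> (\<Union>B\<in>P. B \<times> B)"
    and tree: "\<And>B. B \<in> P \<Longrightarrow> tree_on B (F \<inter> B \<times> B)"
  shows "parts I F = P"
proof -
  have step: "\<exists>B\<in>P. i \<in> B \<and> j \<in> B" if "(i, j) \<in> (F \<union> F\<inverse>)\<^sup>*" "i \<in> I" for i j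
    using that
  proof (induction rule: rtrancl_induct)
    case base
    then show ?case using P by (auto simp: partition_on_def)
  next
    case (step y z)
    then obtain B where B: "B \<in> P" "i \<in> B" "y \<in> B" by auto
    obtain C where C: "C \<in> P" "y \<in> C" "z \<in> C" using step sub by auto
    have "B = C" using P B C by (auto simp: partition_on_def disjoint_def)
    then show ?case using B C by auto
  qed
  have conn: "(i, j) \<in> (F \<union> F\<inverse>)\<^sup>*" if "B \<in> P" "i \<in> B" "j \<in> B" for i j B
  proof -
    have "finite B" using fin P that by (auto simp: partition_on_def intro: finite_subset)
    then obtain r where "r \<in> B" and r: "\<And>k. k \<in> B \<Longrightarrow> (r, k) \<in> F \<inter> B \<times> B"
      by (rule tree_on_root[OF _ tree[OF \<open>B \<in> P\<close>]]) blast
    then have "(i, r) \<in> F \<union> F\<inverse>" "(r, j) \<in> F \<union> F\<inverse>" using r that by auto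
    then show ?thesis by (meson r_into_rtrancl rtrancl_trans)
  qed
  have "{(i, j) \<in> I \<times> I. (i, j) \<in> (F \<union> F\<inverse>)\<^sup>*} = {(x, y). \<exists>p\<in>P. x \<in> p \<and> y \<in> p}"
    using step conn P by (auto simp: partition_on_def)
  then show ?thesis using partition_on_eq_quotient[OF P] by (simp add: parts_def)
qed

lemma forest_on_iff_partition:
  assumes "finite I"
  shows "forest_on I F \<longleftrightarrow>
    (\<exists>P. partition_on I P \<and> F \<subseteq> (\<Union>B\<in>P. B \<times> B) \<and> (\<forall>B\<in>P. tree_on B (F \<inter> B \<times> B)))"
    (is "_ \<longleftrightarrow> ?R")
proof
  assume "forest_on I F"
  then show ?R
    using partition_on_parts[of I F] parts_cover[of F I]
    by (intro exI[of _ "parts I F"]) (fastforce simp: forest_on_def)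
next
  assume ?R
  then obtain P where P: "partition_on I P" "F \<subseteq> (\<Union>B\<in>P. B \<times> B)"
    "\<forall>B\<in>P. tree_on B (F \<inter> B \<times> B)" by auto
  then have "parts I F = P" using parts_unique[OF assms] by auto
  moreover have "F \<subseteq> I \<times> I" using P by (auto simp: partition_on_def)
  ultimately show "forest_on I F" using P by (auto simp: forest_on_def)
qed

lemma tree_on_imp_forest_on:
  assumes "finite I" "tree_on I T"
  shows "forest_on I T" "parts I T = {I}"
proof -
  have "T \<subseteq> I \<times> I" "I \<noteq> {}"
    using assms by (auto simp: tree_on_def partial_order_on_def preorder_on_def minimal_in_def)
  then have *: "partition_on I {I}" "T \<subseteq> (\<Union>B\<in>{I}. B \<times> B)" "\<forall>B\<in>{I}. tree_on B (T \<inter> B \<times> B)"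
    using assms by (auto simp: partition_on_def disjoint_def Int_absorb2)
  show "forest_on I T" using * assms by (subst forest_on_iff_partition) blast+
  show "parts I T = {I}" using * assms parts_unique by blast
qed

lemma subforest_refl: "subforest I F F"
  by (simp add: subforest_def refines_refl partition_on_parts)

lemma subforest_trans:
  assumes "subforest I E F" "subforest I F G"
  shows "subforest I E G"
proof -
  have "E \<inter> B \<times> B = G \<inter> B \<times> B" if B: "B \<in> parts I E" for B
  proof -
    obtain C where "C \<in> parts I F" "B \<subseteq> C"
      using assms(1) B by (auto simp: subforest_def refines_def)
    then have "E \<inter> B \<times> B = F \<inter> B \<times> B" "F \<inter> C \<times> C = G \<inter> C \<times> C" "B \<times> B \<subseteq> C \<times> C"
      using assms B by (auto simp: subforest_def)
    then show ?thesis by blast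
  qed
  then show ?thesis
    using assms by (auto simp: subforest_def intro: refines_trans)
qed

lemma subforest_antisym:
  assumes "forest_on I F" "forest_on I G" "subforest I F G" "subforest I G F"
  shows "F = G"
proof -
  have "E \<subseteq> E'" if "forest_on I E" "subforest I E E'" for E E' :: "'a rel"
  proof (rule subrelI)
    fix i j assume ij: "(i, j) \<in> E"
    then obtain B where "B \<in> parts I E" "i \<in> B" "j \<in> B"
      using parts_cover[of E I i j] \<open>forest_on I E\<close> by (auto simp: forest_on_def)
    then show "(i, j) \<in> E'" using \<open>subforest I E E'\<close> ij by (fastforce simp: subforest_def)
  qed
  then show ?thesis using assms by blast
qed

lemma forest_bot_least:
  assumes fin: "finite I" and F: "forest_on I F"
  shows "forest_on I (forest_bot I)" "subforest I (forest_bot I) F"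
proof -
  define P where "P = (\<lambda>i. {i}) ` I"
  have tr: "tree_on {i} (forest_bot I \<inter> {i} \<times> {i})" if "i \<in> I" for i
  proof -
    have "forest_bot I \<inter> {i} \<times> {i} = {(i, i)}" using that by (auto simp: forest_bot_def)
    then show ?thesis
      by (auto simp: tree_on_def minimal_in_def partial_order_on_def preorder_on_def refl_on_def
          trans_def antisym_def Chains_def)
  qed
  have P: "partition_on I P" "forest_bot I \<subseteq> (\<Union>B\<in>P. B \<times> B)"
    "\<forall>B\<in>P. tree_on B (forest_bot I \<inter> B \<times> B)"
    using tr by (auto simp: P_def partition_on_def disjoint_def forest_bot_def)
  then show "forest_on I (forest_bot I)" using forest_on_iff_partition[OF fin] by blast
  have parts: "parts I (forest_bot I) = P" using P parts_unique[OF fin] by blast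
  have "(i, i) \<in> F" "\<exists>Y\<in>parts I F. i \<in> Y" if i: "i \<in> I" for i
  proof -
    obtain B where B: "B \<in> parts I F" "i \<in> B"
      using partition_on_parts[of I F] i by (auto simp: partition_on_def)
    then show "\<exists>Y\<in>parts I F. i \<in> Y" by auto
    have "tree_on B (F \<inter> B \<times> B)" using F B by (auto simp: forest_on_def)
    then show "(i, i) \<in> F"
      using B by (auto simp: tree_on_def partial_order_on_def preorder_on_def refl_on_def)
  qed
  then show "subforest I (forest_bot I) F"
    unfolding subforest_def refines_def parts
    using P(1) partition_on_parts[of I F] by (auto simp: P_def forest_bot_def)
qed

end

theory Submission
  imports Defs
begin

text \<open>A flat \<open>a\<close> is recovered from \<open>F\<^sub>a\<close> as the set of points that are constant along the relations
  of \<open>F\<^sub>a\<close>; hence \<open>a \<mapsto> F\<^sub>a\<close> is injective and reverse inclusion of flats is inclusion of relations.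
  The order \<open>F\<^sub>a\<close> is a forest because the elements below a given vertex of \<open>T\<close> form a chain, so that
  any two connected vertices of \<open>F\<^sub>a\<close> have a common lower bound. Conversely, for a forest \<open>F \<subseteq> T\<close> the
  indicator functions of the parts of \<open>F\<close> are constant along \<open>F\<close> and separate distinct parts, so no
  relation of \<open>T\<close> outside \<open>F\<close> holds on the whole flat of \<open>F\<close>.\<close>

section \<open>Components of a relation and comparison of forests\<close>

lemma parts_connected:
  assumes "B \<in> parts I F" "i \<in> B" "j \<in> B"
  shows "(i, j) \<in> (F \<union> F\<inverse>)\<^sup>*"
proof -
  obtain k where "(k, i) \<in> (F \<union> F\<inverse>)\<^sup>*" "(k, j) \<in> (F \<union> F\<inverse>)\<^sup>*"
    using assms by (auto simp: parts_def quotient_def)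
  then show ?thesis
    using sym_rtrancl[OF sym_Un_converse[of F]] by (meson rtrancl_trans symD)
qed

lemma parts_closed:
  assumes "B \<in> parts I F" "i \<in> B" "j \<in> I" "(i, j) \<in> (F \<union> F\<inverse>)\<^sup>*"
  shows "j \<in> B"
  using assms by (auto simp: parts_def quotient_def intro: rtrancl_trans)

lemma parts_subset: "B \<in> parts I F \<Longrightarrow> B \<subseteq> I"
  by (auto simp: parts_def quotient_def)

lemma ex_part: "i \<in> I \<Longrightarrow> \<exists>B\<in>parts I F. i \<in> B"
  using partition_on_parts[of I F] by (auto simp: partition_on_def)

lemma refines_parts_mono:
  assumes "F \<subseteq> G"
  shows "refines I (parts I F) (parts I G)"
  unfolding refines_def
proof (intro conjI ballI partition_on_parts)
  fix B assume B: "B \<in> parts I F"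
  then obtain i where i: "i \<in> B"
    using partition_on_parts[of I F] by (metis ex_in_conv partition_on_def)
  then have "i \<in> I" using parts_subset[OF B] by blast
  then obtain C where C: "C \<in> parts I G" "i \<in> C" using ex_part by metis
  have "(F \<union> F\<inverse>)\<^sup>* \<subseteq> (G \<union> G\<inverse>)\<^sup>*"
    using assms by (intro rtrancl_mono) auto
  then have "j \<in> C" if "j \<in> B" for j
    using parts_connected[OF B i that] parts_closed[OF C, of j] parts_subset[OF B] that
    by (meson subsetD)
  then show "\<exists>C\<in>parts I G. B \<subseteq> C" using C(1) by (intro bexI[of _ C] subsetI)
qed

lemma subforest_imp_subset:
  assumes "F \<subseteq> I \<times> I" "subforest I F G"
  shows "F \<subseteq> G"
proof (rule subrelI)
  fix i j assume ij: "(i, j) \<in> F"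
  then obtain B where "B \<in> parts I F" "i \<in> B" "j \<in> B"
    using parts_cover assms(1) by metis
  then show "(i, j) \<in> G" using assms(2) ij by (fastforce simp: subforest_def)
qed

text \<open>A sandwich argument: on a part of \<open>F\<close> the outer relations \<open>F\<close>
  and \<open>H\<close> agree, so \<open>G\<close> between them agrees too. With
  \<open>H = T\<close>, comparing subforests of \<open>T\<close> reduces to inclusion of
  relations.\<close>

lemma subforest_if_subset:
  assumes "subforest I F H" "F \<subseteq> G" "G \<subseteq> H"
  shows "subforest I F G"
  using assms refines_parts_mono[OF assms(2), of I] unfolding subforest_def by blast

section \<open>A criterion for a partial order to be a forest\<close>

lemma connected_common_lower_bound:
  assumes refl: "\<And>i. i \<in> I \<Longrightarrow> (i, i) \<in> F" and tr: "trans F"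
    and down: "\<And>i j k. (i, k) \<in> F \<Longrightarrow> (j, k) \<in> F \<Longrightarrow> (i, j) \<in> F \<or> (j, i) \<in> F"
    and conn: "(i, j) \<in> (F \<union> F\<inverse>)\<^sup>*" and i: "i \<in> I"
  shows "\<exists>k. (k, i) \<in> F \<and> (k, j) \<in> F"
  using conn
\<comment> \<open>Along an upward step the old lower bound survives. After a downward step from
  \<open>j\<close> to \<open>l\<close>, both \<open>k\<close> and \<open>l\<close> lie below
  \<open>j\<close>, so they are comparable and the smaller one is the new bound.\<close>
proof (induction rule: rtrancl_induct)
  case base
  then show ?case using refl i by blast
next
  case (step j l)
  then obtain k where k: "(k, i) \<in> F" "(k, j) \<in> F" by blast
  from step(2) show ?case
  proof
    assume "(j, l) \<in> F"
    then show ?thesis using k tr by (meson transD)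
  next
    assume "(j, l) \<in> F\<inverse>"
    then have l: "(l, j) \<in> F" by simp
    with down k(2) have "(k, l) \<in> F \<or> (l, k) \<in> F" by blast
    \<comment> \<open>Reflexivity is assumed only on \<open>I\<close>, where \<open>l\<close> is not
      known to lie; \<open>down\<close> with both elements equal to \<open>l\<close> supplies
      it.\<close>
    moreover have "(l, l) \<in> F" if "(l, k) \<in> F" using down[OF l l] by blast
    ultimately show ?thesis using k tr by (meson transD)
  qed
qed

text \<open>In each part, finiteness gives a minimal element; two minimal elements have a common
  lower bound and so coincide; intervals are chains by \<open>down\<close>.\<close>

lemma forest_onI:
  assumes fin: "finite I" and po: "partial_order_on I F"
    and down: "\<And>i j k. (i, k) \<in> F \<Longrightarrow> (j, k) \<in> F \<Longrightarrow> (i, j) \<in> F \<or> (j, i) \<in> F"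
  shows "forest_on I F"
proof -
  have F: "F \<subseteq> I \<times> I" and rf: "\<And>i. i \<in> I \<Longrightarrow> (i, i) \<in> F" and tr: "trans F" and asy: "antisym F"
    using po by (auto simp: partial_order_on_def preorder_on_def refl_on_def)
  have "tree_on B (F \<inter> B \<times> B)" if B: "B \<in> parts I F" for B
  proof -
    let ?G = "F \<inter> B \<times> B"
    have BI: "B \<subseteq> I" using parts_subset[OF B] .
    have po': "partial_order_on B ?G"
      using rf asy BI trans_Restr[OF tr, of B]
      by (auto simp: partial_order_on_def preorder_on_def refl_on_def antisym_def)
    \<comment> \<open>Parts are closed downwards, so common lower bounds stay where minimality in
      \<open>B\<close> can be applied to them.\<close>
    have below: "k \<in> B" if "(k, i) \<in> F" "i \<in> B" for k i
    proof (rule parts_closed[OF B that(2)])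
      show "k \<in> I" using that(1) F by blast
      show "(i, k) \<in> (F \<union> F\<inverse>)\<^sup>*" using that(1) by (intro r_into_rtrancl) simp
    qed
    have lower: "\<exists>k\<in>B. (k, i) \<in> F \<and> (k, j) \<in> F" if "i \<in> B" "j \<in> B" for i j
    proof -
      have "i \<in> I" using that(1) BI by blast
      then have "\<exists>k. (k, i) \<in> F \<and> (k, j) \<in> F"
        using connected_common_lower_bound[of I F, OF _ tr _ parts_connected[OF B that]] rf down
        by metis
      then show ?thesis using below that(1) by metis
    qed
    have uniq: "r = s" if "minimal_in B ?G r" "minimal_in B ?G s" for r s
      using lower[of r s] that by (auto simp: minimal_in_def)
    have "finite B" using fin BI by (rule finite_subset[rotated])
    moreover have "asymp_on B (\<lambda>i j. (i, j) \<in> F \<and> i \<noteq> j)"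
      using asy by (auto intro!: asymp_onI dest: antisymD)
    moreover have "transp_on B (\<lambda>i j. (i, j) \<in> F \<and> i \<noteq> j)"
      using asy tr unfolding transp_on_def antisym_def trans_def by metis
    moreover have "B \<noteq> {}"
      using B partition_on_parts[of I F] by (auto simp: partition_on_def)
    ultimately have "\<exists>r\<in>B. \<forall>i\<in>B. i \<noteq> r \<longrightarrow> \<not> ((i, r) \<in> F \<and> i \<noteq> r)"
      by (rule Finite_Set.bex_min_element[of B "\<lambda>i j. (i, j) \<in> F \<and> i \<noteq> j"])
    then obtain r where "minimal_in B ?G r" by (auto simp: minimal_in_def)
    then have "\<exists>!r. minimal_in B ?G r" using uniq by blast
    moreover have "{k. (r, k) \<in> ?G \<and> (k, j) \<in> ?G} \<in> Chains ?G" for r j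
      using down by (auto simp: Chains_def)
    ultimately show ?thesis using po' unfolding tree_on_def by blast
  qed
  then show ?thesis using F by (simp add: forest_on_def)
qed

section \<open>The flat of a forest, inverse to the forest of a flat\<close>

definition flat_of :: "'a set \<Rightarrow> 'a rel \<Rightarrow> ('a \<Rightarrow> complex) set" where
  "flat_of I F = {x \<in> complex_space I. \<forall>(i, j)\<in>F. x i = x j}"

lemma flat_of_antimono: "F \<subseteq> G \<Longrightarrow> flat_of I G \<subseteq> flat_of I F"
  by (auto simp: flat_of_def)

lemma flat_of_in_intersection_lattice:
  assumes "F \<subseteq> T"
  shows "flat_of I F \<in> intersection_lattice I T"
proof -
  \<comment> \<open>Hyperplanes require distinct indices. A diagonal pair imposes no condition, so
    dropping \<open>Id\<close> does not change the intersection.\<close>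
  let ?S = "(\<lambda>(i, j). {x \<in> complex_space I. x i = x j}) ` (F - Id)"
  have "?S \<subseteq> arrangement I T" using assms unfolding arrangement_def by auto
  moreover have "flat_of I F = complex_space I \<inter> \<Inter>?S"
    unfolding flat_of_def by auto
  ultimately show ?thesis unfolding intersection_lattice_def by blast
qed

text \<open>Each hyperplane used to cut out \<open>a\<close> comes from a pair of \<open>T\<close>
  whose form vanishes on \<open>a\<close>, so its equation is among those imposed by the
  forest.\<close>

lemma flat_of_flat_forest:
  assumes "a \<in> intersection_lattice I T"
  shows "flat_of I (flat_forest T a) = a"
proof
  obtain S where S: "S \<subseteq> arrangement I T" and a: "a = complex_space I \<inter> \<Inter>S"
    using assms by (auto simp: intersection_lattice_def)
  show "a \<subseteq> flat_of I (flat_forest T a)"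
    unfolding flat_of_def flat_forest_def using a by auto
  show "flat_of I (flat_forest T a) \<subseteq> a"
  proof
    fix x assume x: "x \<in> flat_of I (flat_forest T a)"
    have "x \<in> h" if h: "h \<in> S" for h
    proof -
      obtain i j where ij: "h = {x \<in> complex_space I. x i = x j}" "(i, j) \<in> T"
        using h S by (auto simp: arrangement_def)
      then have "(i, j) \<in> flat_forest T a"
        using h a by (auto simp: flat_forest_def)
      then show ?thesis using x ij by (auto simp: flat_of_def)
    qed
    then show "x \<in> a" using x a by (auto simp: flat_of_def)
  qed
qed

lemma flat_forest_subset: "flat_forest T a \<subseteq> T"
  by (auto simp: flat_forest_def)

lemma flat_forest_antimono: "b \<subseteq> a \<Longrightarrow> flat_forest T a \<subseteq> flat_forest T b"
  by (auto simp: flat_forest_def)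

text \<open>The definition of a tree speaks only of intervals that start at the root. Since the root
  lies below everything, \<open>i\<close> and \<open>j\<close> both belong to the interval from the
  root to \<open>k\<close>.\<close>

lemma tree_on_down:
  assumes "finite I" "tree_on I T" "(i, k) \<in> T" "(j, k) \<in> T"
  shows "(i, j) \<in> T \<or> (j, i) \<in> T"
proof -
  have T: "T \<subseteq> I \<times> I" and asy: "antisym T"
    using assms(2) by (auto simp: tree_on_def partial_order_on_def preorder_on_def)
  obtain r where r: "r \<in> I" "\<And>i. i \<in> I \<Longrightarrow> (r, i) \<in> T"
    using tree_on_root[OF assms(1,2)] by blast
  then have "minimal_in I T r" using asy by (auto simp: minimal_in_def dest: antisymD)
  then have "{l. (r, l) \<in> T \<and> (l, k) \<in> T} \<in> Chains T"
    using assms(2-) T by (auto simp: tree_on_def)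
  then show ?thesis using r assms T by (auto simp: Chains_def)
qed

lemma forest_on_flat_forest:
  assumes "finite I" "tree_on I T"
  shows "forest_on I (flat_forest T a)"
proof (rule forest_onI[OF assms(1)])
  have T: "T \<subseteq> I \<times> I" "refl_on I T" and tr: "trans T" and asy: "antisym T"
    using assms(2) by (auto simp: tree_on_def partial_order_on_def preorder_on_def)
  have "trans (flat_forest T a)"
  proof (rule transI)
    fix i j k assume ij: "(i, j) \<in> flat_forest T a" and jk: "(j, k) \<in> flat_forest T a"
    then have "(i, k) \<in> T" using transD[OF tr] unfolding flat_forest_def by blast
    moreover have "x i - x k = 0" if "x \<in> a" for x
    proof -
      have "x i - x j = 0" "x j - x k = 0" using ij jk that by (auto simp: flat_forest_def)
      then show ?thesis by simp
    qed
    ultimately show "(i, k) \<in> flat_forest T a" unfolding flat_forest_def by blast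
  qed
  moreover have "antisym (flat_forest T a)"
    using asy flat_forest_subset by (rule antisym_subset[rotated])
  ultimately show "partial_order_on I (flat_forest T a)"
    using T by (auto simp: partial_order_on_def preorder_on_def refl_on_def flat_forest_def)
next
  fix i j k assume "(i, k) \<in> flat_forest T a" "(j, k) \<in> flat_forest T a"
  \<comment> \<open>On \<open>a\<close> the coordinates at \<open>i\<close> and \<open>j\<close>
    both equal the one at \<open>k\<close>, so comparability in \<open>T\<close> passes to the
    forest.\<close>
  then show "(i, j) \<in> flat_forest T a \<or> (j, i) \<in> flat_forest T a"
    using tree_on_down[OF assms, of i k j] by (auto simp: flat_forest_def)
qed

lemma subforest_flat_forest: "subforest I (flat_forest T a) T"
proof -
  \<comment> \<open>Points of \<open>a\<close> are constant on whole parts, not only along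
    relations; hence every relation of \<open>T\<close> inside a part belongs to the forest.\<close>
  have const: "x i = x j" if "(i, j) \<in> (flat_forest T a \<union> (flat_forest T a)\<inverse>)\<^sup>*" "x \<in> a" for i j x
    using that by (induction rule: rtrancl_induct) (auto simp: flat_forest_def)
  have "flat_forest T a \<inter> B \<times> B = T \<inter> B \<times> B" if "B \<in> parts I (flat_forest T a)" for B
    using const[OF parts_connected[OF that]] by (auto simp: flat_forest_def)
  then show ?thesis
    using refines_parts_mono[OF flat_forest_subset, of I T a] by (simp add: subforest_def)
qed

lemma flat_forest_flat_of:
  assumes "F \<subseteq> I \<times> I" "T \<subseteq> I \<times> I" "subforest I F T"
  shows "flat_forest T (flat_of I F) = F"
proof
  show "F \<subseteq> flat_forest T (flat_of I F)"
    using subforest_imp_subset[OF assms(1,3)] by (auto simp: flat_forest_def flat_of_def)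
  show "flat_forest T (flat_of I F) \<subseteq> F"
  proof (rule subrelI)
    fix i j assume ij: "(i, j) \<in> flat_forest T (flat_of I F)"
    then have T: "(i, j) \<in> T" and I: "i \<in> I" "j \<in> I"
      using assms(2) by (auto simp: flat_forest_def)
    obtain B where B: "B \<in> parts I F" "i \<in> B" using ex_part[OF I(1)] by blast
    \<comment> \<open>The indicator of the part of \<open>i\<close>, restricted to \<open>I\<close>
      so that it is extensional and lies in \<open>complex_space I\<close>.\<close>
    define x :: "'a \<Rightarrow> complex" where "x = (\<lambda>k\<in>I. if k \<in> B then 1 else 0)"
    have "k \<in> B \<longleftrightarrow> l \<in> B" if "(k, l) \<in> F" for k l
    proof -
      have "k \<in> I" "l \<in> I" using that assms(1) by auto
      moreover have "(k, l) \<in> (F \<union> F\<inverse>)\<^sup>*" "(l, k) \<in> (F \<union> F\<inverse>)\<^sup>*" using that by auto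
      ultimately show ?thesis using parts_closed[OF B(1)] by metis
    qed
    then have "x \<in> flat_of I F"
      using assms(1) by (auto simp: flat_of_def x_def complex_space_def)
    then have "x i = x j" using ij by (auto simp: flat_forest_def)
    then have "j \<in> B" using B I by (auto simp: x_def split: if_splits)
    \<comment> \<open>Inside the single part \<open>B\<close> the relations \<open>F\<close> and
      \<open>T\<close> agree.\<close>
    then show "(i, j) \<in> F" using B T assms(3) by (auto simp: subforest_def)
  qed
qed

text \<open>Applying \<open>flat_of\<close> turns inclusion of forests back into reverse inclusion
  of flats; the other direction is the sandwich argument below \<open>T\<close>.\<close>

lemma flat_forest_subforest_iff:
  assumes "T \<subseteq> I \<times> I" "a \<in> intersection_lattice I T" "b \<in> intersection_lattice I T"
  shows "subforest I (flat_forest T a) (flat_forest T b) \<longleftrightarrow> b \<subseteq> a"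
proof
  assume "subforest I (flat_forest T a) (flat_forest T b)"
  then have "flat_forest T a \<subseteq> flat_forest T b"
    using subforest_imp_subset flat_forest_subset assms(1) by (metis order_trans)
  then show "b \<subseteq> a"
    using flat_of_antimono flat_of_flat_forest assms(2,3) by metis
next
  assume "b \<subseteq> a"
  then show "subforest I (flat_forest T a) (flat_forest T b)"
    using subforest_if_subset subforest_flat_forest flat_forest_antimono flat_forest_subset
    by metis
qed

lemma order_isomorphism_inv_into:
  assumes "order_isomorphism A leA B leB f"
  shows "order_isomorphism B leB A leA (inv_into A f)"
proof -
  have "inv_into A f y \<in> A" "f (inv_into A f y) = y" if "y \<in> B" for y
    using assms that
    by (auto simp: order_isomorphism_def bij_betw_def intro: inv_into_into f_inv_into_f)
  then show ?thesis
    using assms by (auto simp: order_isomorphism_def bij_betw_inv_into)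
qed

theorem theorem2:
  fixes I :: "'a set" and T :: "'a rel"
  assumes "finite I" and "tree_on I T"
  shows "(\<exists>f. order_isomorphism
             (forest_interval I (forest_bot I) T) (subforest I)
             (intersection_lattice I T) (\<lambda>a b. a \<supseteq> b) f)
       \<and> bij_betw (flat_forest T) (intersection_lattice I T)
             {F. forest_on I F \<and> subforest I F T}
       \<and> forest_interval I (forest_bot I) T = {F. forest_on I F \<and> subforest I F T}
       \<and> (\<forall>a\<in>intersection_lattice I T. \<forall>b\<in>intersection_lattice I T.
             a \<supseteq> b \<longleftrightarrow> subforest I (flat_forest T a) (flat_forest T b))"
proof -
  have T: "T \<subseteq> I \<times> I"
    using assms(2) by (auto simp: tree_on_def partial_order_on_def preorder_on_def)
  let ?L = "intersection_lattice I T" and ?P = "{F. forest_on I F \<and> subforest I F T}"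
  have bij: "bij_betw (flat_forest T) ?L ?P"
  proof (rule bij_betw_byWitness[where f' = "flat_of I"])
    show "\<forall>a\<in>?L. flat_of I (flat_forest T a) = a" using flat_of_flat_forest by blast
    show "\<forall>F\<in>?P. flat_forest T (flat_of I F) = F"
      using flat_forest_flat_of[OF _ T] by (auto simp: forest_on_def)
    show "flat_forest T ` ?L \<subseteq> ?P"
      using forest_on_flat_forest[OF assms] subforest_flat_forest by blast
    show "flat_of I ` ?P \<subseteq> ?L"
      using flat_of_in_intersection_lattice subforest_imp_subset unfolding forest_on_def by blast
  qed
  have int: "forest_interval I (forest_bot I) T = ?P"
    using forest_bot_least(2)[OF assms(1)] by (auto simp: forest_interval_def)
  have ord: "\<forall>a\<in>?L. \<forall>b\<in>?L. a \<supseteq> b \<longleftrightarrow> subforest I (flat_forest T a) (flat_forest T b)"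
    using flat_forest_subforest_iff[OF T] by blast
  have "order_isomorphism ?L (\<lambda>a b. a \<supseteq> b) ?P (subforest I) (flat_forest T)"
    unfolding order_isomorphism_def using bij ord by blast
  \<comment> \<open>The isomorphism is stated from the interval to the lattice, so its witness is
    the inverse of \<open>flat_forest T\<close>.\<close>
  then have "\<exists>f. order_isomorphism ?P (subforest I) ?L (\<lambda>a b. a \<supseteq> b) f"
    using order_isomorphism_inv_into by blast
  then show ?thesis using bij int ord by simp
qed

end
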